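(* Let $A,B\in\mathbb{C}^{m\times n}$ with $\operatorname{rank}(A)=r\ge 1$ and $\operatorname{rank}(B)=s\ge 1$, and let $E=B-A$ and $\widetilde{E}=B^{\dagger}-A^{\dagger}$. For parameters $\xi\in[0,1]$ and $\eta\in[0,1]$ define \[ \Phi(\xi):=\xi\big(\|E\|_{F}^{2}-\|A\widetilde{E}B\|_{F}^{2}\big)+(1-\xi)\big(\|\widetilde{E}\|_{F}^{2}-\|B^{\dagger}EA^{\dagger}\|_{F}^{2}\big), \] \[ \Psi(\eta):=\eta\big(\|E\|_{F}^{2}-\|B\widetilde{E}A\|_{F}^{2}\big)+(1-\eta)\big(\|\widetilde{E}\|_{F}^{2}-\|A^{\dagger}EB^{\dagger}\|_{F}^{2}\big). \] Then, for all $\xi,\eta\in[0,1]$, \[ \|P_{B}-P_{A}\|_{F}^{2}+\max\bigg\{\frac{J_{A}(\xi)}{J_{B}(\xi)},\frac{J_{B}(\eta)}{J_{A}(\eta)}\bigg\}\|P_{B^{\ast}}-P_{A^{\ast}}\|_{F}^{2}\geq\frac{\Phi(\xi)}{J_{B}(\xi)}+\frac{\Psi(\eta)}{J_{A}(\eta)}, \] \[ \|P_{B}-P_{A}\|_{F}^{2}+\|P_{B^{\ast}}-P_{A^{\ast}}\|_{F}^{2}\geq\frac{\Phi(\xi)+\Psi(\eta)}{\max\big\{J_{A}(\xi),J_{B}(\xi),J_{A}(\eta),J_{B}(\eta)\big\}}. \] In particular, if $s=r$, then \[ J_{B}(\xi)\|P_{B}-P_{A}\|_{F}^{2}+J_{A}(\xi)\|P_{B^{\ast}}-P_{A^{\ast}}\|_{F}^{2}\geq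 2\Phi(\xi), \] \[ J_{A}(\eta)\|P_{B}-P_{A}\|_{F}^{2}+J_{B}(\eta)\|P_{B^{\ast}}-P_{A^{\ast}}\|_{F}^{2}\geq 2\Psi(\eta). \]
   Context: For a complex matrix $M$: $M^{\ast}$ is the conjugate transpose, $M^{\dagger}$ the Moore--Penrose inverse, $\|M\|_{F}$ the Frobenius norm, $\|M\|_{2}$ the spectral norm, and $P_{M}=MM^{\dagger}$ the orthogonal projection onto the column space of $M$ (so $P_{M^{\ast}}=M^{\dagger}M$). For $M\in\mathbb{C}^{m\times n}\setminus\{0\}$ and $t\in[0,1]$, define \[ J_{M}(t):=t\|M\|_{2}^{2}+(1-t)\|M^{\dagger}\|_{2}^{2}. \] *)

theory Defs
  imports "HOL-Analysis.Analysis"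
begin

text \<open>
  An $m \times n$ complex matrix is an element of \<^typ>\<open>complex ^ 'n ^ 'm\<close> (row index type \<open>'m\<close>).
\<close>

definition ctranspose :: "complex ^ 'n ^ 'm \<Rightarrow> complex ^ 'm ^ 'n" where
  "ctranspose M = (\<chi> i j. cnj (M $ j $ i))"

definition is_moore_penrose :: "complex ^ 'n ^ 'm \<Rightarrow> complex ^ 'm ^ 'n \<Rightarrow> bool" where
  "is_moore_penrose M X \<longleftrightarrow>
     M ** X ** M = M \<and> X ** M ** X = X \<and>
     ctranspose (M ** X) = M ** X \<and> ctranspose (X ** M) = X ** M"

text \<open>Well defined by the lemma \<open>ex1_moore_penrose\<close> below.\<close>

definition pinv :: "complex ^ 'n ^ 'm \<Rightarrow> complex ^ 'm ^ 'n" where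
  "pinv M = (THE X. is_moore_penrose M X)"

text \<open>
  The norm of the type \<^typ>\<open>complex ^ 'n ^ 'm\<close> is the Euclidean norm of the vector of Euclidean
  norms of the rows, i.e. the Frobenius norm and not the operator norm.
\<close>

abbreviation frobenius_norm :: "complex ^ 'n ^ 'm \<Rightarrow> real" where
  "frobenius_norm M \<equiv> norm M"

lemma frobenius_norm_entries:
  "frobenius_norm M = sqrt (\<Sum>i\<in>UNIV. \<Sum>j\<in>UNIV. (cmod (M $ i $ j))\<^sup>2)"
  by (simp add: norm_vec_def L2_set_def sum_nonneg)

definition spectral_norm :: "complex ^ 'n ^ 'm \<Rightarrow> real" where
  "spectral_norm M = onorm (\<lambda>x. M *v x)"

definition col_proj :: "complex ^ 'n ^ 'm \<Rightarrow> complex ^ 'm ^ 'm" where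
  "col_proj M = M ** pinv M"

definition J :: "complex ^ 'n ^ 'm \<Rightarrow> real \<Rightarrow> real" where
  "J M t = t * (spectral_norm M)\<^sup>2 + (1 - t) * (spectral_norm (pinv M))\<^sup>2"

definition Phi :: "complex ^ 'n ^ 'm \<Rightarrow> complex ^ 'n ^ 'm \<Rightarrow> real \<Rightarrow> real" where
  "Phi A B \<xi> = (let E = B - A; E' = pinv B - pinv A in
     \<xi> * ((frobenius_norm E)\<^sup>2 - (frobenius_norm (A ** E' ** B))\<^sup>2) +
     (1 - \<xi>) * ((frobenius_norm E')\<^sup>2 - (frobenius_norm (pinv B ** E ** pinv A))\<^sup>2))"

definition Psi :: "complex ^ 'n ^ 'm \<Rightarrow> complex ^ 'n ^ 'm \<Rightarrow> real \<Rightarrow> real" where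
  "Psi A B \<eta> = (let E = B - A; E' = pinv B - pinv A in
     \<eta> * ((frobenius_norm E)\<^sup>2 - (frobenius_norm (B ** E' ** A))\<^sup>2) +
     (1 - \<eta>) * ((frobenius_norm E')\<^sup>2 - (frobenius_norm (pinv A ** E ** pinv B))\<^sup>2))"

lemma ctranspose_ctranspose [simp]: "ctranspose (ctranspose M) = M"
  by (simp add: ctranspose_def vec_eq_iff)

lemma ctranspose_mult: "ctranspose (M ** N) = ctranspose N ** ctranspose M"
  by (simp add: ctranspose_def matrix_matrix_mult_def vec_eq_iff mult.commute)

lemma ctranspose_diff: "ctranspose (M - N) = ctranspose M - ctranspose N"
  by (simp add: ctranspose_def vec_eq_iff)

lemma matrix_diff_ldistrib: "M ** (N - K) = M ** N - M ** K" for M :: "'a::ring_1 ^ 'n ^ 'm"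
  by (simp add: matrix_matrix_mult_def vec_eq_iff right_diff_distrib sum_subtractf)

lemma matrix_diff_rdistrib: "(N - K) ** M = N ** M - K ** M" for M :: "'a::ring_1 ^ 'n ^ 'm"
  by (simp add: matrix_matrix_mult_def vec_eq_iff left_diff_distrib sum_subtractf)

lemma ctranspose_mult_self_eq_0:
  assumes "ctranspose M ** M = 0"
  shows "M = 0"
proof -
  have "M $ i $ j = 0" for i j
  proof -
    have "(\<Sum>k\<in>UNIV. cnj (M $ k $ j) * M $ k $ j) = (ctranspose M ** M) $ j $ j"
      by (simp add: ctranspose_def matrix_matrix_mult_def)
    also have "\<dots> = 0"
      using assms by simp
    finally have "complex_of_real (\<Sum>k\<in>UNIV. (cmod (M $ k $ j))\<^sup>2) = 0"
      by (simp only: of_real_sum complex_norm_square mult.commute)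
    then have "(\<Sum>k\<in>UNIV. (cmod (M $ k $ j))\<^sup>2) = 0"
      by (simp only: of_real_eq_0_iff)
    then have "(cmod (M $ i $ j))\<^sup>2 = 0"
      by (subst (asm) sum_nonneg_eq_0_iff) auto
    then show ?thesis by simp
  qed
  then show ?thesis by (simp add: vec_eq_iff)
qed

lemma ex_generalized_inverse:
  fixes M :: "'a::field ^ 'n ^ 'm"
  shows "\<exists>G. M ** G ** M = M"
proof -
  have "\<exists>g. range g \<subseteq> UNIV \<and> Vector_Spaces.linear (*s) (*s) g \<and>
    (\<forall>v \<in> range ((*v) M). M *v g v = v)"
    using vec.linear_exists_right_inverse_on[OF matrix_vector_mul_linear_gen vec.subspace_UNIV]
    by blast
  then obtain g where g: "Vector_Spaces.linear (*s) (*s) g" "\<And>x. M *v g (M *v x) = M *v x"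
    by blast
  have "M ** matrix g ** M = M"
    by (simp add: matrix_eq matrix_vector_mul_assoc[symmetric] matrix_works[OF g(1)] g(2))
  then show ?thesis by blast
qed

lemma ex_inverse_13:
  "\<exists>X. M ** X ** M = M \<and> ctranspose (M ** X) = M ** X"
proof -
  let ?T = "ctranspose M"
  obtain G where G: "(?T ** M) ** G ** (?T ** M) = ?T ** M"
    using ex_generalized_inverse by blast
  let ?X = "G ** ?T"
  let ?D = "M ** ?X ** M - M"
  have "?T ** ?D = 0"
    using G by (simp add: matrix_diff_ldistrib matrix_mul_assoc)
  then have "ctranspose ?D ** ?D = 0"
    by (simp add: ctranspose_diff ctranspose_mult matrix_diff_rdistrib
        flip: matrix_mul_assoc)
  then have 1: "M ** ?X ** M = M"
    using ctranspose_mult_self_eq_0[of ?D] by simp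
  have 2: "(M ** ?X) ** ctranspose (M ** ?X) = ctranspose (M ** ?X)"
    using 1 by (simp add: ctranspose_mult matrix_mul_assoc)
  have "ctranspose (M ** ?X) = M ** ?X"
    using arg_cong[OF 2, of ctranspose] 2
    by (simp only: ctranspose_mult ctranspose_ctranspose)
  then show ?thesis using 1 by blast
qed

lemma ex_moore_penrose: "\<exists>X. is_moore_penrose M X"
proof -
  obtain X where X: "M ** X ** M = M" "ctranspose (M ** X) = M ** X"
    using ex_inverse_13 by blast
  obtain Y where Y: "ctranspose M ** Y ** ctranspose M = ctranspose M"
      "ctranspose (ctranspose M ** Y) = ctranspose M ** Y"
    using ex_inverse_13 by blast
  let ?Z = "ctranspose Y"
  have Z: "M ** ?Z ** M = M" "ctranspose (?Z ** M) = ?Z ** M"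
    using arg_cong[OF Y(1), of ctranspose] Y(2)
    by (simp_all add: ctranspose_mult matrix_mul_assoc)
  let ?W = "?Z ** M ** X"
  have l: "M ** ?W = M ** X" and r: "?W ** M = ?Z ** M"
    using X(1) Z(1) by (metis matrix_mul_assoc)+
  have "?W ** M ** ?W = ?W"
    using l r by (metis Z(1) matrix_mul_assoc)
  then have "is_moore_penrose M ?W"
    unfolding is_moore_penrose_def using l r X Z by simp
  then show ?thesis by blast
qed

lemma moore_penrose_unique:
  assumes "is_moore_penrose M X" "is_moore_penrose M Y"
  shows "X = Y"
proof -
  have "M ** X = (M ** Y) ** (M ** X)"
    using assms unfolding is_moore_penrose_def by (metis matrix_mul_assoc)
  then have "M ** X = ctranspose (M ** Y ** (M ** X))"
    using assms unfolding is_moore_penrose_def by metis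
  also have "\<dots> = (M ** X) ** (M ** Y)"
    using assms unfolding is_moore_penrose_def by (metis ctranspose_mult)
  also have "\<dots> = M ** Y"
    using assms unfolding is_moore_penrose_def by (metis matrix_mul_assoc)
  finally have l: "M ** X = M ** Y" .
  have "X ** M = (X ** M) ** (Y ** M)"
    using assms unfolding is_moore_penrose_def by (metis matrix_mul_assoc)
  then have "X ** M = ctranspose ((X ** M) ** (Y ** M))"
    using assms unfolding is_moore_penrose_def by metis
  also have "\<dots> = (Y ** M) ** (X ** M)"
    using assms unfolding is_moore_penrose_def by (metis ctranspose_mult)
  also have "\<dots> = Y ** M"
    using assms unfolding is_moore_penrose_def by (metis matrix_mul_assoc)
  finally have r: "X ** M = Y ** M" .
  show ?thesis
    using assms l r unfolding is_moore_penrose_def by (metis matrix_mul_assoc)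
qed

lemma ex1_moore_penrose: "\<exists>!X. is_moore_penrose M X"
  using ex_moore_penrose moore_penrose_unique by blast

lemma is_moore_penrose_pinv: "is_moore_penrose M (pinv M)"
  unfolding pinv_def using ex1_moore_penrose by (rule theI')

lemma pinv_eqI: "is_moore_penrose M X \<Longrightarrow> pinv M = X"
  using is_moore_penrose_pinv moore_penrose_unique by blast

lemma pinv_ctranspose: "pinv (ctranspose M) = ctranspose (pinv M)"
proof (rule pinv_eqI)
  show "is_moore_penrose (ctranspose M) (ctranspose (pinv M))"
    using is_moore_penrose_pinv[of M] unfolding is_moore_penrose_def
    by (metis ctranspose_mult ctranspose_ctranspose matrix_mul_assoc)
qed

lemma col_proj_ctranspose: "col_proj (ctranspose M) = pinv M ** M"
  using is_moore_penrose_pinv[of M]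
  by (simp add: col_proj_def pinv_ctranspose is_moore_penrose_def flip: ctranspose_mult)

end

theory Submission
  imports Defs
begin

text \<open>
  Write $P, P'$ for the projections onto the column spaces of $A, A^*$ and $Q, Q'$ for those of
  $B, B^*$. Splitting $E$ along $P$ on the left and $Q'$ on the right gives three orthogonal
  pieces, one of which is $-A\widetilde{E}B$; the other two are
  $(I-P)B = (I-P)Q \cdot B$ and $A(I-Q') = A \cdot P'(I-Q')$. The same splitting of
  $\widetilde{E}$, with the roles of the matrices exchanged, yields
  $\Phi(\xi) \le J_B(\xi) \|(I-P)Q\|_F^2 + J_A(\xi) \|P'(I-Q')\|_F^2$, and $\Psi$ is $\Phi$ with
  $A$ and $B$ swapped. Everything follows from
  $\|Q-P\|_F^2 = \|(I-P)Q\|_F^2 + \|(I-Q)P\|_F^2$, where the two summands are equal if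
  the ranks are, because the trace of a projection depends only on its rank.
\<close>

subsection \<open>Frobenius and spectral norms\<close>

text \<open>The trace form turns moving a factor across \<open>inner\<close> into cyclicity of the
  trace; orthogonality and Pythagoras below refer to this real inner product.\<close>

lemma inner_matrix_eq_trace: "inner X Y = Re (trace (ctranspose X ** Y))"
proof -
  have "inner X Y = (\<Sum>i\<in>UNIV. \<Sum>j\<in>UNIV. Re (cnj (X $ i $ j) * Y $ i $ j))"
    by (simp add: inner_vec_def inner_complex_def)
  also have "\<dots> = (\<Sum>j\<in>UNIV. \<Sum>i\<in>UNIV. Re (cnj (X $ i $ j) * Y $ i $ j))"
    by (rule sum.swap)
  finally show ?thesis
    by (simp add: trace_def ctranspose_def matrix_matrix_mult_def)
qed

lemma inner_matrix_mult_left: "inner (C ** X) Y = inner X (ctranspose C ** Y)"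
  by (simp add: inner_matrix_eq_trace ctranspose_mult matrix_mul_assoc)

lemma inner_matrix_mult_right: "inner (X ** C) Y = inner X (Y ** ctranspose C)"
  by (simp add: inner_matrix_eq_trace ctranspose_mult matrix_mul_assoc
      trace_mul_sym[of "ctranspose X ** Y" "ctranspose C"])

lemma norm_ctranspose: "norm (ctranspose M) = norm (M :: complex ^ 'n ^ 'm)"
proof -
  have "(\<Sum>i\<in>UNIV. \<Sum>j\<in>UNIV. (cmod (M $ j $ i))\<^sup>2) = (\<Sum>j\<in>UNIV. \<Sum>i\<in>UNIV. (cmod (M $ j $ i))\<^sup>2)"
    by (rule sum.swap)
  then show ?thesis
    by (simp add: frobenius_norm_entries ctranspose_def)
qed

lemma norm_matrix_columns: "(norm (M :: complex ^ 'n ^ 'm))\<^sup>2 = (\<Sum>j\<in>UNIV. (norm (column j M))\<^sup>2)"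
proof -
  have "(norm M)\<^sup>2 = (\<Sum>i\<in>UNIV. \<Sum>j\<in>UNIV. (cmod (M $ i $ j))\<^sup>2)"
    by (simp add: frobenius_norm_entries sum_nonneg)
  also have "\<dots> = (\<Sum>j\<in>UNIV. \<Sum>i\<in>UNIV. (cmod (M $ i $ j))\<^sup>2)"
    by (rule sum.swap)
  finally show ?thesis
    by (simp add: norm_vec_def L2_set_def column_def sum_nonneg)
qed

lemma norm_matrix_vector_le: "norm (A *v x) \<le> spectral_norm A * norm x"
  unfolding spectral_norm_def by (rule onorm) simp

lemma spectral_norm_nonneg: "0 \<le> spectral_norm A"
  unfolding spectral_norm_def by (rule onorm_pos_le) simp

lemma spectral_norm_pos:
  assumes "A \<noteq> 0"
  shows "0 < spectral_norm A"
proof -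
  have "(\<lambda>x. A *v x) \<noteq> (\<lambda>x. 0)"
    using assms by (metis matrix_eq matrix_vector_mult_0)
  then show ?thesis
    unfolding spectral_norm_def by (subst onorm_pos_lt) (auto simp: fun_eq_iff)
qed

text \<open>The columns of \<open>A ** X\<close> are the images under \<open>A\<close> of the
  columns of \<open>X\<close>, and squared Frobenius norms add up over columns.\<close>

lemma norm_matrix_mult_le1: "norm (A ** X) \<le> spectral_norm A * norm X"
proof -
  have "(norm (A ** X))\<^sup>2 = (\<Sum>j\<in>UNIV. (norm (A *v column j X))\<^sup>2)"
    by (simp add: norm_matrix_columns column_def matrix_matrix_mult_def matrix_vector_mult_def)
  also have "\<dots> \<le> (\<Sum>j\<in>UNIV. (spectral_norm A * norm (column j X))\<^sup>2)"
    by (intro sum_mono power_mono norm_matrix_vector_le) simp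
  also have "\<dots> = (spectral_norm A * norm X)\<^sup>2"
    by (simp add: power_mult_distrib norm_matrix_columns sum_distrib_left)
  finally show ?thesis
    by (rule power2_le_imp_le) (simp add: spectral_norm_nonneg)
qed

text \<open>Follows from the bound for left multiplication by \<open>A\<close> through adjointness
  and Cauchy-Schwarz, so the spectral norms of \<open>A\<close> and its adjoint need not be
  compared.\<close>

lemma norm_matrix_mult_le2: "norm (X ** A) \<le> norm X * spectral_norm A"
proof -
  let ?Y = "ctranspose A ** ctranspose X"
  have Y: "?Y = ctranspose (X ** A)"
    by (simp add: ctranspose_mult)
  have "(norm ?Y)\<^sup>2 = inner (ctranspose X) (A ** ?Y)"
    by (simp add: power2_norm_eq_inner inner_matrix_mult_left)
  also have "\<dots> \<le> norm X * norm (A ** ?Y)"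
    using norm_cauchy_schwarz[of "ctranspose X" "A ** ?Y"] by (simp add: norm_ctranspose)
  also have "\<dots> \<le> norm X * (spectral_norm A * norm ?Y)"
    by (intro mult_left_mono norm_matrix_mult_le1) simp
  finally have "norm ?Y * norm ?Y \<le> (norm X * spectral_norm A) * norm ?Y"
    by (simp add: power2_eq_square mult.assoc)
  then have "norm ?Y \<le> norm X * spectral_norm A"
    by (cases "norm ?Y = 0") (simp_all add: spectral_norm_nonneg)
  then show ?thesis
    by (simp only: Y norm_ctranspose)
qed

subsection \<open>Orthogonal projections\<close>

definition orth_proj :: "complex ^ 'n ^ 'n \<Rightarrow> bool" where
  "orth_proj P \<longleftrightarrow> ctranspose P = P \<and> P ** P = P"

lemma orth_proj_pinv: "orth_proj (M ** pinv M)" "orth_proj (pinv M ** M)"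
  using is_moore_penrose_pinv[of M]
  unfolding orth_proj_def is_moore_penrose_def by (metis matrix_mul_assoc)+

text \<open>Both bracketings occur, so that the equations rewrite products associated either
  way.\<close>

lemma pinv_absorb:
  "M ** pinv M ** M = M" "pinv M ** M ** pinv M = pinv M"
  "M ** (pinv M ** M) = M" "pinv M ** (M ** pinv M) = pinv M"
  using is_moore_penrose_pinv[of M]
  by (simp_all add: is_moore_penrose_def matrix_mul_assoc)

lemma norm_split_left:
  assumes "orth_proj P"
  shows "(norm M)\<^sup>2 = (norm (P ** M))\<^sup>2 + (norm (M - P ** M))\<^sup>2"
proof -
  have "inner (P ** M) (M - P ** M) = 0"
    using assms by (simp add: inner_matrix_mult_left orth_proj_def matrix_diff_ldistrib matrix_mul_assoc)
  then show ?thesis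
    using norm_add_Pythagorean[of "P ** M" "M - P ** M"] by (simp add: orthogonal_def)
qed

lemma norm_split_right:
  assumes "orth_proj P"
  shows "(norm M)\<^sup>2 = (norm (M ** P))\<^sup>2 + (norm (M - M ** P))\<^sup>2"
proof -
  have "inner (M ** P) (M - M ** P) = 0"
    using assms by (simp add: inner_matrix_mult_right orth_proj_def matrix_diff_rdistrib
        flip: matrix_mul_assoc)
  then show ?thesis
    using norm_add_Pythagorean[of "M ** P" "M - M ** P"] by (simp add: orthogonal_def)
qed

text \<open>Pythagoras twice: \<open>P\<close> on the left splits \<open>B - A\<close> into
  \<open>P ** B - A\<close> and \<open>B - P ** B\<close>, then \<open>Q\<close> on the right splits
  the first piece.\<close>

lemma norm_diff_split:
  assumes "orth_proj P" "orth_proj Q" "P ** A = A" "B ** Q = B"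
  shows "(norm (B - A))\<^sup>2 = (norm (P ** B - A ** Q))\<^sup>2 + (norm (B - P ** B))\<^sup>2 + (norm (A - A ** Q))\<^sup>2"
proof -
  let ?F = "P ** (B - A)"
  have F: "?F = P ** B - A"
    using assms by (simp add: matrix_diff_ldistrib)
  have "?F ** Q = P ** B - A ** Q"
    unfolding F using assms by (simp add: matrix_diff_rdistrib flip: matrix_mul_assoc)
  moreover have "?F - ?F ** Q = - (A - A ** Q)"
    unfolding calculation by (simp add: F)
  moreover have "B - A - ?F = B - P ** B"
    by (simp add: F)
  ultimately show ?thesis
    using norm_split_left[OF assms(1), of "B - A"] norm_split_right[OF assms(2), of ?F]
    by (simp only: norm_minus_cancel)
qed

text \<open>The two matrices are adjoint to each other.\<close>

lemma norm_orth_proj_diff_swap: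
  assumes "orth_proj P" "orth_proj Q"
  shows "norm (Q - Q ** P) = norm (Q - P ** Q)"
  using norm_ctranspose[of "Q - P ** Q"] assms
  by (simp add: orth_proj_def ctranspose_diff ctranspose_mult)

text \<open>The case \<open>A = P\<close>, \<open>B = Q\<close> of \<open>norm_diff_split\<close>,
  where the corner term \<open>P ** Q - P ** Q\<close> vanishes.\<close>

lemma norm_orth_proj_diff:
  assumes "orth_proj P" "orth_proj Q"
  shows "(norm (Q - P))\<^sup>2 = (norm (Q - P ** Q))\<^sup>2 + (norm (P - Q ** P))\<^sup>2"
  using norm_diff_split[of P Q P Q] norm_orth_proj_diff_swap[of Q P] assms
  by (simp add: orth_proj_def)

text \<open>Isolates the asymmetry between \<open>P\<close> and \<open>Q\<close>: the trace of
  \<open>P ** Q\<close> is symmetric in them, so only the trace of \<open>Q\<close> changes under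
  exchange.\<close>

lemma norm_orth_proj_diff_trace:
  assumes "orth_proj P" "orth_proj Q"
  shows "(norm (Q - P ** Q))\<^sup>2 = Re (trace Q) - Re (trace (P ** Q))"
proof -
  have "ctranspose (Q - P ** Q) ** (Q - P ** Q) = (Q - Q ** P) ** (Q - P ** Q)"
    using assms by (simp add: orth_proj_def ctranspose_diff ctranspose_mult)
  also have "\<dots> = Q ** Q - Q ** P ** Q - (Q ** P ** Q - Q ** (P ** P) ** Q)"
    by (simp add: matrix_diff_ldistrib matrix_diff_rdistrib matrix_mul_assoc)
  also have "\<dots> = Q - Q ** P ** Q"
    using assms by (simp add: orth_proj_def)
  finally have "(norm (Q - P ** Q))\<^sup>2 = Re (trace Q) - Re (trace (Q ** (P ** Q)))"
    by (simp add: power2_norm_eq_inner inner_matrix_eq_trace trace_sub matrix_mul_assoc)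
  also have "trace (Q ** (P ** Q)) = trace (P ** Q)"
    using assms by (simp add: trace_mul_sym[of Q] orth_proj_def flip: matrix_mul_assoc)
  finally show ?thesis .
qed

lemma norm_orth_proj_diff_half:
  assumes "orth_proj P" "orth_proj Q" "trace P = trace Q"
  shows "2 * (norm (Q - P ** Q))\<^sup>2 = (norm (Q - P))\<^sup>2"
  using norm_orth_proj_diff[OF assms(1,2)] norm_orth_proj_diff_trace[OF assms(1,2)]
    norm_orth_proj_diff_trace[OF assms(2,1)] assms(3) trace_mul_sym[of P Q]
  by simp

subsection \<open>Rank and trace\<close>

text \<open>
  An isomorphism $f$ between the two ranges, with inverse $g$, makes $X = fP$ and $Y = gQ$
  satisfy $YX = P$ and $XY = Q$.
\<close>

lemma trace_idempotent_cong_dim: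
  fixes P :: "'a::field ^ 'n ^ 'n" and Q :: "'a ^ 'm ^ 'm"
  assumes P: "P ** P = P" and Q: "Q ** Q = Q"
    and dim: "vec.dim (range ((*v) P)) = vec.dim (range ((*v) Q))"
  shows "trace P = trace Q"
proof -
  have sub: "vec.subspace (range ((*v) P))" "vec.subspace (range ((*v) Q))"
    by (simp_all add: vec.subspace_image)
  obtain f where f: "Vector_Spaces.linear (*s) (*s) f"
    "f ` range ((*v) P) = range ((*v) Q)" "inj_on f (range ((*v) P))"
    using vec.subspace_isomorphism[OF sub dim] by blast
  obtain g where g: "Vector_Spaces.linear (*s) (*s) g" "\<And>v. v \<in> range ((*v) P) \<Longrightarrow> g (f v) = v"
    using vec.linear_exists_left_inverse_on[OF f(1) sub(1) f(3)] by blast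
  have PP: "P *v (P *v x) = P *v x" for x
    by (simp add: matrix_vector_mul_assoc P)
  have QQ: "Q *v (Q *v x) = Q *v x" for x
    by (simp add: matrix_vector_mul_assoc Q)
  have Qf: "Q *v f (P *v x) = f (P *v x)" for x
  proof -
    have "f (P *v x) \<in> range ((*v) Q)"
      using f(2) by blast
    then show ?thesis
      using QQ by auto
  qed
  \<comment> \<open>Each \<open>Q *v y\<close> is \<open>f (P *v x)\<close> for some
    \<open>x\<close>, and \<open>g\<close> sends it back to \<open>P *v x\<close>.\<close>
  have gP: "P *v g (Q *v y) = g (Q *v y)" "f (g (Q *v y)) = Q *v y" for y
  proof -
    obtain x where "Q *v y = f (P *v x)"
      using f(2) by (metis (no_types, lifting) imageE rangeI)
    then show "P *v g (Q *v y) = g (Q *v y)" "f (g (Q *v y)) = Q *v y"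
        using g(2)[of "P *v x"] PP[of x] by simp_all
  qed
  let ?X = "matrix f ** P" and ?Y = "matrix g ** Q"
  have mf: "matrix f *v x = f x" for x
    by (rule matrix_works[OF f(1)])
  have mg: "matrix g *v x = g x" for x
    by (rule matrix_works[OF g(1)])
  have "?Y ** ?X *v x = P *v x" for x
    by (simp only: matrix_vector_mul_assoc[symmetric] mf mg Qf g(2)[OF rangeI])
  moreover have "?X ** ?Y *v y = Q *v y" for y
    by (simp only: matrix_vector_mul_assoc[symmetric] mf mg gP)
  ultimately have "?Y ** ?X = P" "?X ** ?Y = Q"
    by (simp_all add: matrix_eq)
  then show ?thesis
    by (metis trace_mul_sym)
qed

text \<open>The rows of \<open>M\<close> are the columns of its transpose, and the range of a matrix
  is the span of its columns, which are the images of the unit vectors.\<close>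

lemma rank_eq_dim_range_transpose:
  fixes M :: "'a::field ^ 'n ^ 'm"
  shows "rank M = vec.dim (range ((*v) (transpose M)))"
proof -
  have "column i (transpose M) \<in> range ((*v) (transpose M))" for i
  proof
    show "column i (transpose M) = transpose M *v axis i 1"
      by (simp only: matrix_vector_mult_def)
        (simp add: vec_eq_iff column_def axis_def if_distrib cong: if_cong)
  qed simp
  then have "vec.span (columns (transpose M)) \<subseteq> range ((*v) (transpose M))"
    by (intro vec.span_minimal vec.subspace_image vec.subspace_UNIV) (auto simp only: columns_def)
  then have "range ((*v) (transpose M)) = vec.span (columns (transpose M))"
    using matrix_vector_mult_in_columnspace_gen by blast
  then have "vec.dim (range ((*v) (transpose M))) = vec.dim (columns (transpose M))"
    by (simp only: vec.dim_span)
  then show ?thesis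
    by (simp only: columns_transpose row_rank_def_gen)
qed

lemma trace_transpose: "trace (transpose M) = trace M"
  by (simp add: trace_def transpose_def)

lemma trace_pinv_cong_rank:
  fixes A B :: "complex ^ 'n ^ 'm"
  assumes "rank A = rank B"
  shows "trace (pinv A ** A) = trace (pinv B ** B)" "trace (A ** pinv A) = trace (B ** pinv B)"
proof -
  \<comment> \<open>\<^const>\<open>rank\<close> is the row rank, hence the transposes\<close>
  have idem: "transpose (pinv M ** M) ** transpose (pinv M ** M) = transpose (pinv M ** M)"
    for M :: "complex ^ 'n ^ 'm"
    using orth_proj_pinv(2)[of M] by (simp add: orth_proj_def flip: matrix_transpose_mul)
  have range: "range ((*v) (transpose (pinv M ** M))) = range ((*v) (transpose M))"
    for M :: "complex ^ 'n ^ 'm"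
  proof -
    \<comment> \<open>Each transpose factors through the other, the second time because
      \<open>M ** (pinv M ** M) = M\<close>.\<close>
    have "transpose (pinv M ** M) *v x = transpose M *v (transpose (pinv M) *v x)" for x
      by (simp only: matrix_vector_mul_assoc matrix_transpose_mul)
    moreover have "transpose M *v x = transpose (pinv M ** M) *v (transpose M *v x)" for x
      by (simp only: matrix_vector_mul_assoc pinv_absorb flip: matrix_transpose_mul)
    ultimately show ?thesis
      by (metis (no_types, lifting) image_subset_iff rangeI subset_antisym)
  qed
  have "trace (transpose (pinv A ** A)) = trace (transpose (pinv B ** B))"
    using assms by (intro trace_idempotent_cong_dim idem) (simp only: range rank_eq_dim_range_transpose)
  then show "trace (pinv A ** A) = trace (pinv B ** B)"
    by (simp only: trace_transpose)
  then show "trace (A ** pinv A) = trace (B ** pinv B)"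
    by (simp only: trace_mul_sym[of A] trace_mul_sym[of B])
qed

subsection \<open>The perturbation bounds\<close>

lemma norm_diff_bound:
  fixes A B :: "complex ^ 'n ^ 'm"
  shows "(norm (B - A))\<^sup>2 - (norm (A ** (pinv B - pinv A) ** B))\<^sup>2
    \<le> (spectral_norm B)\<^sup>2 * (norm (B ** pinv B - A ** pinv A ** (B ** pinv B)))\<^sup>2
      + (spectral_norm A)\<^sup>2 * (norm (pinv A ** A - pinv B ** B ** (pinv A ** A)))\<^sup>2"
proof -
  let ?P = "A ** pinv A" and ?P' = "pinv A ** A" and ?Q = "B ** pinv B" and ?Q' = "pinv B ** B"
  \<comment> \<open>Both sides expand to \<open>A ** pinv A ** B - A ** pinv B ** B\<close>; this
    identifies the corner term of the splitting.\<close>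
  have "?P ** B - A ** ?Q' = - (A ** (pinv B - pinv A) ** B)"
    by (simp add: matrix_diff_ldistrib matrix_diff_rdistrib matrix_mul_assoc)
  then have eq: "(norm (B - A))\<^sup>2 - (norm (A ** (pinv B - pinv A) ** B))\<^sup>2
      = (norm (B - ?P ** B))\<^sup>2 + (norm (A - A ** ?Q'))\<^sup>2"
    using norm_diff_split[OF orth_proj_pinv(1)[of A] orth_proj_pinv(2)[of B], of A B]
    by (simp add: pinv_absorb norm_minus_cancel)
  \<comment> \<open>Since \<open>B = ?Q ** B\<close>, the matrix on the left is
    \<open>(?Q - ?P ** ?Q) ** B\<close>.\<close>
  have "norm (B - ?P ** B) \<le> norm (?Q - ?P ** ?Q) * spectral_norm B"
    using norm_matrix_mult_le2[of "?Q - ?P ** ?Q" B]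
    by (simp add: matrix_diff_rdistrib pinv_absorb flip: matrix_mul_assoc)
  then have 1: "(norm (B - ?P ** B))\<^sup>2 \<le> (spectral_norm B)\<^sup>2 * (norm (?Q - ?P ** ?Q))\<^sup>2"
    by (metis norm_ge_zero power_mono power_mult_distrib mult.commute)
  have "norm (A - A ** ?Q') \<le> spectral_norm A * norm (?P' - ?P' ** ?Q')"
    using norm_matrix_mult_le1[of A "?P' - ?P' ** ?Q'"]
    by (simp add: matrix_diff_ldistrib pinv_absorb matrix_mul_assoc)
  then have 2: "(norm (A - A ** ?Q'))\<^sup>2 \<le> (spectral_norm A)\<^sup>2 * (norm (?P' - ?Q' ** ?P'))\<^sup>2"
    unfolding norm_orth_proj_diff_swap[OF orth_proj_pinv(2) orth_proj_pinv(2)]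
    by (metis norm_ge_zero power_mono power_mult_distrib)
  show ?thesis
    using eq 1 2 by simp
qed

lemma pinv_pinv: "pinv (pinv M) = M"
  using is_moore_penrose_pinv[of M] by (intro pinv_eqI) (simp add: is_moore_penrose_def)

lemma norm_mult_diff_commute:
  fixes C :: "complex ^ 'p ^ 'q"
  shows "norm (C ** (X - Y) ** D) = norm (C ** (Y - X) ** D)"
  using norm_minus_commute[of "C ** X ** D" "C ** Y ** D"]
  by (simp add: matrix_diff_ldistrib matrix_diff_rdistrib)

lemma Phi_le:
  fixes A B :: "complex ^ 'n ^ 'm"
  assumes "\<xi> \<in> {0..1}"
  shows "Phi A B \<xi> \<le> J B \<xi> * (norm (B ** pinv B - A ** pinv A ** (B ** pinv B)))\<^sup>2
    + J A \<xi> * (norm (pinv A ** A - pinv B ** B ** (pinv A ** A)))\<^sup>2"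
    (is "_ \<le> J B \<xi> * ?x + J A \<xi> * ?y")
proof -
  let ?E = "B - A" and ?E' = "pinv B - pinv A"
  \<comment> \<open>Here \<open>pinv B\<close> plays the role of \<open>A\<close> and
    \<open>pinv A\<close> that of \<open>B\<close>; with \<open>pinv_pinv\<close> this exchange
    reproduces the same \<open>?x\<close> and \<open>?y\<close>.\<close>
  have 1: "(norm ?E')\<^sup>2 - (norm (pinv B ** ?E ** pinv A))\<^sup>2
      \<le> (spectral_norm (pinv B))\<^sup>2 * ?x + (spectral_norm (pinv A))\<^sup>2 * ?y"
    using norm_diff_bound[of "pinv A" "pinv B"]
    by (simp add: pinv_pinv norm_minus_commute[of "pinv A"] norm_mult_diff_commute[of _ A]
        add.commute)
  have "Phi A B \<xi> = \<xi> * ((norm ?E)\<^sup>2 - (norm (A ** ?E' ** B))\<^sup>2)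
      + (1 - \<xi>) * ((norm ?E')\<^sup>2 - (norm (pinv B ** ?E ** pinv A))\<^sup>2)"
    by (simp add: Phi_def Let_def)
  also have "\<dots> \<le> \<xi> * ((spectral_norm B)\<^sup>2 * ?x + (spectral_norm A)\<^sup>2 * ?y)
      + (1 - \<xi>) * ((spectral_norm (pinv B))\<^sup>2 * ?x + (spectral_norm (pinv A))\<^sup>2 * ?y)"
    using assms by (intro add_mono mult_left_mono norm_diff_bound 1) auto
  also have "\<dots> = J B \<xi> * ?x + J A \<xi> * ?y"
    by (simp add: J_def algebra_simps)
  finally show ?thesis .
qed

text \<open>Exchanging \<open>A\<close> and \<open>B\<close> only flips the signs of both
  differences, which the norms ignore.\<close>

lemma Psi_eq_Phi: "Psi A B \<eta> = Phi B A \<eta>"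
  unfolding Psi_def Phi_def Let_def
  by (simp only: norm_minus_commute[of A B] norm_minus_commute[of "pinv A" "pinv B"]
      norm_mult_diff_commute[of B "pinv B"] norm_mult_diff_commute[of "pinv A" B])

text \<open>Justifies the divisions by \<open>J\<close>. Both spectral norms are positive, as
  \<open>pinv A = 0\<close> would give \<open>A = A ** pinv A ** A = 0\<close>.\<close>

lemma J_pos:
  assumes "A \<noteq> 0" "t \<in> {0..1}"
  shows "0 < J A t"
proof -
  have "pinv A \<noteq> 0"
    using assms(1) pinv_absorb(1)[of A] by auto
  then have "0 < (spectral_norm A)\<^sup>2" "0 < (spectral_norm (pinv A))\<^sup>2"
    using spectral_norm_pos[of A] spectral_norm_pos[of "pinv A"] assms(1) by simp_all
  then show ?thesis
    using assms(2) unfolding J_def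
    by (cases "t = 0") (auto intro!: add_pos_nonneg mult_pos_pos mult_nonneg_nonneg)
qed

lemma rank_0_field: "rank (0 :: 'a::field ^ 'n ^ 'm) = 0"
  unfolding row_rank_def_gen by (auto simp: rows_def row_def vec_eq_iff)

theorem theorem3p7:
  fixes A B :: "complex ^ 'n ^ 'm" and r s :: nat and \<xi> \<eta> :: real
  assumes "rank A = r" and "r \<ge> 1" and "rank B = s" and "s \<ge> 1"
    and "\<xi> \<in> {0..1}" and "\<eta> \<in> {0..1}"
  shows
    "(frobenius_norm (col_proj B - col_proj A))\<^sup>2
       + max (J A \<xi> / J B \<xi>) (J B \<eta> / J A \<eta>)
         * (frobenius_norm (col_proj (ctranspose B) - col_proj (ctranspose A)))\<^sup>2
     \<ge> Phi A B \<xi> / J B \<xi> + Psi A B \<eta> / J A \<eta>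
     \<and>
     (frobenius_norm (col_proj B - col_proj A))\<^sup>2
       + (frobenius_norm (col_proj (ctranspose B) - col_proj (ctranspose A)))\<^sup>2
     \<ge> (Phi A B \<xi> + Psi A B \<eta>) / Max {J A \<xi>, J B \<xi>, J A \<eta>, J B \<eta>}
     \<and>
     (s = r \<longrightarrow>
       J B \<xi> * (frobenius_norm (col_proj B - col_proj A))\<^sup>2
         + J A \<xi> * (frobenius_norm (col_proj (ctranspose B) - col_proj (ctranspose A)))\<^sup>2
       \<ge> 2 * Phi A B \<xi>
       \<and>
       J A \<eta> * (frobenius_norm (col_proj B - col_proj A))\<^sup>2
         + J B \<eta> * (frobenius_norm (col_proj (ctranspose B) - col_proj (ctranspose A)))\<^sup>2
       \<ge> 2 * Psi A B \<eta>)"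
proof -
  let ?P = "A ** pinv A" and ?P' = "pinv A ** A" and ?Q = "B ** pinv B" and ?Q' = "pinv B ** B"
  define x where "x = (norm (?Q - ?P ** ?Q))\<^sup>2"
  define x' where "x' = (norm (?P - ?Q ** ?P))\<^sup>2"
  define y where "y = (norm (?P' - ?Q' ** ?P'))\<^sup>2"
  define y' where "y' = (norm (?Q' - ?P' ** ?Q'))\<^sup>2"
  have nonneg: "0 \<le> x" "0 \<le> x'" "0 \<le> y" "0 \<le> y'"
    by (simp_all add: x_def x'_def y_def y'_def)
  have "A \<noteq> 0" "B \<noteq> 0"
    using assms(1-4) rank_0_field[where 'a=complex and 'n='n and 'm='m] by auto
  then have pos: "0 < J A \<xi>" "0 < J B \<xi>" "0 < J A \<eta>" "0 < J B \<eta>"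
    using assms(5,6) by (simp_all add: J_pos)
  have Phi: "Phi A B \<xi> \<le> J B \<xi> * x + J A \<xi> * y"
    unfolding x_def y_def using Phi_le[OF assms(5)] .
  have Psi: "Psi A B \<eta> \<le> J A \<eta> * x' + J B \<eta> * y'"
    unfolding x'_def y'_def Psi_eq_Phi using Phi_le[OF assms(6)] .
  have n1: "(norm (col_proj B - col_proj A))\<^sup>2 = x + x'"
    unfolding col_proj_def x_def x'_def
    by (intro norm_orth_proj_diff orth_proj_pinv)
  have n2: "(norm (col_proj (ctranspose B) - col_proj (ctranspose A)))\<^sup>2 = y + y'"
    unfolding col_proj_ctranspose y_def y'_def
    by (subst add.commute) (intro norm_orth_proj_diff orth_proj_pinv)

  \<comment> \<open>After division \<open>x\<close> and \<open>x'\<close> have coefficient 1, while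
    \<open>y\<close> and \<open>y'\<close> carry the two ratios, each at most their
    \<open>max\<close>.\<close>
  have "Phi A B \<xi> / J B \<xi> + Psi A B \<eta> / J A \<eta>
      \<le> (J B \<xi> * x + J A \<xi> * y) / J B \<xi> + (J A \<eta> * x' + J B \<eta> * y') / J A \<eta>"
    using Phi Psi pos by (intro add_mono divide_right_mono) auto
  also have "\<dots> = x + x' + (J A \<xi> / J B \<xi> * y + J B \<eta> / J A \<eta> * y')"
    using pos by (simp add: add_divide_distrib)
  also have "\<dots> \<le> x + x' + (max (J A \<xi> / J B \<xi>) (J B \<eta> / J A \<eta>) * y
      + max (J A \<xi> / J B \<xi>) (J B \<eta> / J A \<eta>) * y')"
    using nonneg by (intro add_mono mult_right_mono) auto
  finally have 1: "Phi A B \<xi> / J B \<xi> + Psi A B \<eta> / J A \<eta>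
      \<le> x + x' + max (J A \<xi> / J B \<xi>) (J B \<eta> / J A \<eta>) * (y + y')"
    by (simp only: distrib_left)

  let ?m = "Max {J A \<xi>, J B \<xi>, J A \<eta>, J B \<eta>}"
  have m: "J A \<xi> \<le> ?m" "J B \<xi> \<le> ?m" "J A \<eta> \<le> ?m" "J B \<eta> \<le> ?m"
    by (auto intro!: Max_ge)
  have "Phi A B \<xi> + Psi A B \<eta> \<le> (J B \<xi> * x + J A \<xi> * y) + (J A \<eta> * x' + J B \<eta> * y')"
    using Phi Psi by (rule add_mono)
  also have "\<dots> \<le> (?m * x + ?m * y) + (?m * x' + ?m * y')"
    by (intro add_mono mult_right_mono m nonneg)
  also have "\<dots> = (x + x' + (y + y')) * ?m"
    by (simp only: algebra_simps)
  finally have 2: "(Phi A B \<xi> + Psi A B \<eta>) / ?m \<le> x + x' + (y + y')"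
    using less_le_trans[OF pos(1) m(1)] by (simp only: pos_divide_le_eq)

  have 3: "2 * Phi A B \<xi> \<le> J B \<xi> * (x + x') + J A \<xi> * (y + y')
      \<and> 2 * Psi A B \<eta> \<le> J A \<eta> * (x + x') + J B \<eta> * (y + y')" if "s = r"
  proof -
    have tr: "trace ?P' = trace ?Q'" "trace ?P = trace ?Q"
      using trace_pinv_cong_rank[of A B] that assms by simp_all
    \<comment> \<open>Equal traces split each squared projection distance into equal halves, so
      \<open>x = x'\<close> and \<open>y = y'\<close>; doubling the bounds on \<open>Phi\<close> and
      \<open>Psi\<close> then gives the claim.\<close>
    have "2 * x = x + x'"
      unfolding n1[symmetric] unfolding x_def col_proj_def
      by (intro norm_orth_proj_diff_half orth_proj_pinv tr)
    moreover have "2 * y' = y + y'"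
      unfolding n2[symmetric] unfolding y'_def col_proj_ctranspose
      by (intro norm_orth_proj_diff_half orth_proj_pinv tr)
    ultimately have "x = x'" "y = y'"
      by simp_all
    then show ?thesis
      using Phi Psi by (simp add: algebra_simps)
  qed
  show ?thesis
    unfolding n1 n2 using 1 2 3 by blast
qed

end
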